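(* $(\mathcal{T}_\Omega^\circ,\unlhd)$ is a right and a left pre-Lie algebra, and $(\mathcal{T}_\Omega^\circ,\lhd)$ is a left pre-Lie algebra.
   Context: $\mathbb{K}$ is a field and $\Omega$ a set of decorations (finite, or such that the spaces of trees with $n$ vertices are themselves graded with finite-dimensional components). $\mathcal{T}_\Omega^\circ$ is the $\mathbb{K}$-vector space with basis the $\Omega$-decorated finite non-planar rooted trees (up to isomorphism), including the empty tree $\emptyset$ (it is the graded dual of the space of rooted trees, with the dual basis identified with trees). $\ell(T)$ denotes the set of leaves of $T$. For trees $T,T'$ and $v\in V(T)$, $T\underset{v}{\curvearrowleft}T'$ is the tree obtained by grafting the root of $T'$ as a new direct descendant of $v$ (with $T\underset{v}{\curvearrowleft}\emptyset=T$). The bilinear products $\lhd,\unlhd$ on $\mathcal{T}_\Omega^\circ$ are defined on trees by $\emptyset\lhd T'=T'$; $T\lhd T'=\sum_{l\in\ell(T)}T\underset{l}{\curvearrowleft}T'$ if $T\neq\emptyset$; and $T\unlhd T'=0$ if $|\ell(T)|>1$, $T\unlhd T'=T\lhd T'$ otherwise. Terminology: an algebra $(B,\star)$ is called here right pre-Lie if $(x\star y)\star z-x\star(y\star z)=(y\star x)\star z-y\star(x\star z)$ for all $x,y,z\in B$, and left pre-Lie if $(x\star y)\star z-x\star(y\star z)=(x\star z)\star y-x\star(z\star y)$ for all $x,y,z\in B$. *)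

theory Defs
  imports Complex_Main "HOL-Library.Poly_Mapping"
begin

text \<open>
  A nonempty non-planar rooted tree decorated by the type \<open>'w\<close> (the set \<open>\<Omega>\<close>) is
  an isomorphism class of concrete trees \<open>'w otree\<close>. In a concrete tree the children of a vertex
  are listed, so that a vertex can be named by its address: the list of child positions
  leading to it from the root, whose address is \<open>[]\<close>. The isomorphisms forget the order.
\<close>

datatype 'w otree = Node 'w "'w otree list"

type_synonym address = "nat list"

fun subtree :: "'w otree \<Rightarrow> address \<Rightarrow> 'w otree option" where
  "subtree t [] = Some t"
| "subtree (Node a ts) (i # v) = (if i < length ts then subtree (ts ! i) v else None)"

definition verts :: "'w otree \<Rightarrow> address set" where
  "verts t = {v. subtree t v \<noteq> None}"

definition decoration :: "'w otree \<Rightarrow> address \<Rightarrow> 'w" where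
  "decoration t v = (case the (subtree t v) of Node a ts \<Rightarrow> a)"

definition child :: "address \<Rightarrow> address \<Rightarrow> bool" where
  "child v w \<longleftrightarrow> (\<exists>i. w = v @ [i])"

definition leaves :: "'w otree \<Rightarrow> address set" where
  "leaves t = {v \<in> verts t. \<forall>w \<in> verts t. \<not> child v w}"

text \<open>\<open>graft t v t'\<close> makes the root of \<open>t'\<close> a new (last) child of \<open>v\<close>; used only for
  \<open>v \<in> verts t\<close>.\<close>

fun graft :: "'w otree \<Rightarrow> address \<Rightarrow> 'w otree \<Rightarrow> 'w otree" where
  "graft (Node a ts) [] t' = Node a (ts @ [t'])"
| "graft (Node a ts) (i # v) t' = Node a (ts[i := graft (ts ! i) v t'])"

definition is_iso :: "(address \<Rightarrow> address) \<Rightarrow> 'w otree \<Rightarrow> 'w otree \<Rightarrow> bool" where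
  "is_iso f t s \<longleftrightarrow>
     bij_betw f (verts t) (verts s) \<and> f [] = [] \<and>
     (\<forall>v \<in> verts t. decoration s (f v) = decoration t v) \<and>
     (\<forall>v \<in> verts t. \<forall>w \<in> verts t. child (f v) (f w) \<longleftrightarrow> child v w)"

definition otree_iso :: "'w otree \<Rightarrow> 'w otree \<Rightarrow> bool" where
  "otree_iso t s \<longleftrightarrow> (\<exists>f. is_iso f t s)"

lemma root_in_verts [simp]: "[] \<in> verts t"
  by (simp add: verts_def)

lemma finite_verts: "finite (verts t)"
proof (induction t)
  case (Node a ts)
  have "verts (Node a ts) \<subseteq> insert [] (\<Union>i \<in> {..<length ts}. (#) i ` verts (ts ! i))"
  proof
    fix v assume "v \<in> verts (Node a ts)"
    then show "v \<in> insert [] (\<Union>i \<in> {..<length ts}. (#) i ` verts (ts ! i))"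
      by (cases v) (auto simp: verts_def split: if_splits)
  qed
  then show ?case using Node by (rule_tac finite_subset) auto
qed

lemma is_iso_id: "is_iso id t t"
  by (simp add: is_iso_def)

lemma is_iso_inv:
  assumes "is_iso f t s" shows "is_iso (inv_into (verts t) f) s t"
proof -
  let ?g = "inv_into (verts t) f"
  have b: "bij_betw f (verts t) (verts s)" using assms by (simp add: is_iso_def)
  have g: "bij_betw ?g (verts s) (verts t)" by (rule bij_betw_inv_into[OF b])
  have fg: "f (?g v) = v" if "v \<in> verts s" for v using b that by (rule bij_betw_inv_into_right)
  have gin: "?g v \<in> verts t" if "v \<in> verts s" for v using g that by (rule bij_betwE[rule_format])
  have g0: "?g [] = []"
    using bij_betw_inv_into_left[OF b, of "[]"] assms by (simp add: is_iso_def)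
  show ?thesis unfolding is_iso_def
  proof (intro conjI ballI)
    show "decoration t (?g v) = decoration s v" if "v \<in> verts s" for v
      using assms fg[OF that] gin[OF that] by (metis is_iso_def)
    show "child (?g v) (?g w) \<longleftrightarrow> child v w" if "v \<in> verts s" "w \<in> verts s" for v w
    proof -
      have "child (f (?g v)) (f (?g w)) \<longleftrightarrow> child (?g v) (?g w)"
        using assms gin[OF that(1)] gin[OF that(2)] unfolding is_iso_def by blast
      then show ?thesis by (simp only: fg[OF that(1)] fg[OF that(2)])
    qed
  qed (use g g0 in auto)
qed

lemma is_iso_comp:
  assumes "is_iso f t s" "is_iso g s r" shows "is_iso (g \<circ> f) t r"
proof -
  have fin: "f v \<in> verts s" if "v \<in> verts t" for v
    using assms(1) that unfolding is_iso_def by (blast dest: bij_betwE)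
  have "bij_betw (g \<circ> f) (verts t) (verts r)"
    using assms unfolding is_iso_def by (metis bij_betw_trans)
  moreover have "(g \<circ> f) [] = []" using assms by (simp add: is_iso_def)
  moreover have "decoration r ((g \<circ> f) v) = decoration t v" if "v \<in> verts t" for v
    using assms fin[OF that] that by (simp add: is_iso_def)
  moreover have "child ((g \<circ> f) v) ((g \<circ> f) w) \<longleftrightarrow> child v w"
    if "v \<in> verts t" "w \<in> verts t" for v w
    using assms fin[OF that(1)] fin[OF that(2)] that by (simp add: is_iso_def)
  ultimately show ?thesis unfolding is_iso_def by blast
qed

lemma equivp_otree_iso: "equivp otree_iso"
proof (rule equivpI)
  show "reflp otree_iso"
    unfolding otree_iso_def by (rule reflpI) (rule exI, rule is_iso_id)
  show "symp otree_iso"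
    unfolding otree_iso_def by (rule sympI) (meson is_iso_inv)
  show "transp otree_iso"
    unfolding otree_iso_def by (rule transpI) (meson is_iso_comp)
qed

quotient_type 'w rtree = "'w otree" / otree_iso
  by (rule equivp_otree_iso)

definition nch :: "'w otree \<Rightarrow> address \<Rightarrow> nat" where
  "nch t v = (case the (subtree t v) of Node a ts \<Rightarrow> length ts)"

lemma subtree_append:
  "subtree t (v @ w) = (case subtree t v of None \<Rightarrow> None | Some s \<Rightarrow> subtree s w)"
  by (induction t v rule: subtree.induct) auto

lemma verts_prefix: "v @ w \<in> verts t \<Longrightarrow> v \<in> verts t"
  by (auto simp: verts_def subtree_append split: option.splits)

lemma new_not_in_verts: "v @ nch t v # w \<notin> verts t"
proof (cases "subtree t v")
  case None
  then show ?thesis by (simp add: verts_def subtree_append)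
next
  case (Some s)
  then show ?thesis by (cases s) (simp add: verts_def subtree_append nch_def)
qed

lemma subtree_graft_old:
  "v \<in> verts t \<Longrightarrow> u \<in> verts t \<Longrightarrow>
     u \<in> verts (graft t v t') \<and> decoration (graft t v t') u = decoration t u"
proof (induction t v t' arbitrary: u rule: graft.induct)
  case (1 a ts t')
  then show ?case
    by (cases u) (auto simp: verts_def decoration_def nth_append split: if_splits)
next
  case (2 a ts i v t')
  show ?case
  proof (cases u)
    case Nil
    then show ?thesis by (simp add: verts_def decoration_def)
  next
    case (Cons j u')
    then show ?thesis using 2
      by (cases "i = j") (auto simp: verts_def decoration_def split: if_splits)
  qed
qed

lemma subtree_graft_new:
  "v \<in> verts t \<Longrightarrow> subtree (graft t v t') (v @ nch t v # w) = subtree t' w"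
proof (induction t v t' rule: graft.induct)
  case (1 a ts t')
  then show ?case by (simp add: nch_def)
next
  case (2 a ts i v t')
  then show ?case by (auto simp: nch_def verts_def split: if_splits)
qed

lemma verts_graftD:
  "v \<in> verts t \<Longrightarrow> u \<in> verts (graft t v t') \<Longrightarrow>
     u \<in> verts t \<or> (\<exists>w \<in> verts t'. u = v @ nch t v # w)"
proof (induction t v t' arbitrary: u rule: graft.induct)
  case (1 a ts t')
  then show ?case
    by (cases u) (auto simp: verts_def nch_def nth_append less_Suc_eq split: if_splits)
next
  case (2 a ts i v t')
  show ?case
  proof (cases u)
    case Nil
    then show ?thesis by simp
  next
    case (Cons j u')
    then show ?thesis using 2
      by (cases "i = j") (auto simp: verts_def nch_def split: if_splits)
  qed
qed

lemma verts_graft: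
  assumes "v \<in> verts t"
  shows "verts (graft t v t') = verts t \<union> (\<lambda>w. v @ nch t v # w) ` verts t'"
proof -
  have "v @ nch t v # w \<in> verts (graft t v t')" if "w \<in> verts t'" for w
    using that by (simp add: verts_def subtree_graft_new[OF assms])
  then show ?thesis
    using subtree_graft_old[OF assms] verts_graftD[OF assms] by blast
qed

lemma decoration_graft_new:
  "v \<in> verts t \<Longrightarrow> decoration (graft t v t') (v @ nch t v # w) = decoration t' w"
  by (simp add: decoration_def subtree_graft_new)

lemma child_old_new:
  assumes "u \<in> verts t"
  shows "child u (v @ nch t v # w) \<longleftrightarrow> u = v \<and> w = []"
proof
  assume "child u (v @ nch t v # w)"
  then obtain i where i: "v @ nch t v # w = u @ [i]" by (auto simp: child_def)
  show "u = v \<and> w = []"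
  proof (cases w rule: rev_exhaust)
    case Nil
    then show ?thesis using i by simp
  next
    case (snoc w' j)
    then have "u = v @ nch t v # w'" using i by simp
    then show ?thesis using assms new_not_in_verts by metis
  qed
qed (auto simp: child_def)

lemma not_child_new_old:
  assumes "u \<in> verts t"
  shows "\<not> child (v @ nch t v # w) u"
proof
  assume "child (v @ nch t v # w) u"
  then obtain i where "u = v @ nch t v # (w @ [i])" by (auto simp: child_def)
  then show False using assms new_not_in_verts by metis
qed

lemma child_new_new: "child (v @ n # w) (v @ n # w') \<longleftrightarrow> child w w'"
  by (auto simp: child_def)

lemma graft_iso:
  assumes f: "is_iso f t s" and g: "is_iso g t' s'" and v: "v \<in> verts t"
  shows "otree_iso (graft t v t') (graft s (f v) s')"
proof -
  define old where "old = (\<lambda>w. v @ nch t v # w)"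
  define new where "new = (\<lambda>w. f v @ nch s (f v) # w)"
  define h where "h u = (if u \<in> verts t then f u else new (g (inv old u)))" for u
  have fb: "bij_betw f (verts t) (verts s)" and gb: "bij_betw g (verts t') (verts s')"
    and f0: "f [] = []" and g0: "g [] = []"
    using f g by (auto simp: is_iso_def)
  have fin: "f u \<in> verts s" if "u \<in> verts t" for u using bij_betwE[OF fb] that by blast
  have gin: "g u \<in> verts s'" if "u \<in> verts t'" for u using bij_betwE[OF gb] that by blast
  have V: "verts (graft t v t') = verts t \<union> old ` verts t'"
    unfolding old_def by (rule verts_graft[OF v])
  have W: "verts (graft s (f v) s') = verts s \<union> new ` verts s'"
    unfolding new_def by (rule verts_graft[OF fin[OF v]])
  have injold: "inj old" and injnew: "inj new" by (auto simp: old_def new_def inj_def)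
  have nold: "old w \<notin> verts t" for w unfolding old_def by (rule new_not_in_verts)
  have nnew: "new w \<notin> verts s" for w unfolding new_def by (rule new_not_in_verts)
  have hf: "h u = f u" if "u \<in> verts t" for u using that by (simp add: h_def)
  have hg: "h (old w) = new (g w)" for w using nold injold by (simp add: h_def)
  have b1: "bij_betw h (verts t) (verts s)"
    using fb hf by (simp cong: bij_betw_cong)
  have b2: "bij_betw h (old ` verts t') (new ` verts s')"
  proof -
    have "bij_betw (new \<circ> g) (verts t') (new ` verts s')"
      using gb injnew by (auto intro: bij_betw_trans inj_on_imp_bij_betw inj_on_subset)
    then have "bij_betw (h \<circ> old) (verts t') (new ` verts s')"
      using hg by (simp cong: bij_betw_cong)
    then show ?thesis using injold
      by (metis bij_betw_comp_iff inj_on_imp_bij_betw inj_on_subset subset_UNIV)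
  qed
  have b: "bij_betw h (verts (graft t v t')) (verts (graft s (f v) s'))"
    unfolding V W using b1 b2 nnew by (intro bij_betw_combine) auto
  have fchild: "child (f u) (f w) \<longleftrightarrow> child u w" if "u \<in> verts t" "w \<in> verts t" for u w
    using f that by (simp add: is_iso_def)
  have gchild: "child (g u) (g w) \<longleftrightarrow> child u w" if "u \<in> verts t'" "w \<in> verts t'" for u w
    using g that by (simp add: is_iso_def)
  have finj: "f u = f v \<longleftrightarrow> u = v" if "u \<in> verts t" for u
    using fb that v by (auto simp: bij_betw_def inj_on_def)
  have ginj: "g w = [] \<longleftrightarrow> w = []" if "w \<in> verts t'" for w
    using gb that g0 root_in_verts[of t'] unfolding bij_betw_def inj_on_def by metis
  have "is_iso h (graft t v t') (graft s (f v) s')"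
    unfolding is_iso_def
  proof (intro conjI ballI b)
    show "h [] = []" using hf f0 by simp
  next
    fix u assume "u \<in> verts (graft t v t')"
    then consider "u \<in> verts t" | w where "u = old w" "w \<in> verts t'" unfolding V by blast
    then show "decoration (graft s (f v) s') (h u) = decoration (graft t v t') u"
    proof cases
      case 1
      then show ?thesis
        using hf fin v f subtree_graft_old[OF v 1] subtree_graft_old[OF fin[OF v] fin[OF 1]]
        by (simp add: is_iso_def)
    next
      case 2
      have "decoration (graft s (f v) s') (new (g w)) = decoration s' (g w)"
        unfolding new_def by (rule decoration_graft_new[OF fin[OF v]])
      moreover have "decoration (graft t v t') (old w) = decoration t' w"
        unfolding old_def by (rule decoration_graft_new[OF v])
      ultimately show ?thesis using 2 hg g by (simp add: is_iso_def)
    qed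
  next
    fix u w
    assume "u \<in> verts (graft t v t')" "w \<in> verts (graft t v t')"
    then have "u \<in> verts t \<or> (\<exists>x \<in> verts t'. u = old x)"
      "w \<in> verts t \<or> (\<exists>y \<in> verts t'. w = old y)" unfolding V by auto
    then consider "u \<in> verts t" "w \<in> verts t"
      | y where "u \<in> verts t" "w = old y" "y \<in> verts t'"
      | x where "u = old x" "x \<in> verts t'" "w \<in> verts t"
      | x y where "u = old x" "x \<in> verts t'" "w = old y" "y \<in> verts t'" by blast
    then show "child (h u) (h w) \<longleftrightarrow> child u w"
    proof cases
      case 1
      then show ?thesis using hf fchild by simp
    next
      case 2
      have "child (f u) (new (g y)) \<longleftrightarrow> f u = f v \<and> g y = []"
        unfolding new_def by (rule child_old_new[OF fin[OF 2(1)]])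
      moreover have "child u (old y) \<longleftrightarrow> u = v \<and> y = []"
        unfolding old_def by (rule child_old_new[OF 2(1)])
      ultimately show ?thesis using 2 hf hg finj ginj by simp
    next
      case 3
      have "\<not> child (new (g x)) (f w)"
        unfolding new_def by (rule not_child_new_old[OF fin[OF 3(3)]])
      moreover have "\<not> child (old x) w"
        unfolding old_def by (rule not_child_new_old[OF 3(3)])
      ultimately show ?thesis using 3 hf hg by simp
    next
      case 4
      have "child (new (g x)) (new (g y)) \<longleftrightarrow> child (g x) (g y)"
        unfolding new_def by (rule child_new_new)
      moreover have "child (old x) (old y) \<longleftrightarrow> child x y"
        unfolding old_def by (rule child_new_new)
      ultimately show ?thesis using 4 hg gchild by simp
    qed
  qed
  then show ?thesis unfolding otree_iso_def by blast
qed

lemma bij_betw_leaves: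
  assumes f: "is_iso f t s"
  shows "bij_betw f (leaves t) (leaves s)"
proof -
  have fb: "bij_betw f (verts t) (verts s)" using f by (simp add: is_iso_def)
  then have im: "f ` verts t = verts s" and inj: "inj_on f (verts t)"
    by (auto simp: bij_betw_def)
  have ch: "child (f v) (f w) \<longleftrightarrow> child v w" if "v \<in> verts t" "w \<in> verts t" for v w
    using f that by (simp add: is_iso_def)
  have eq: "f v \<in> leaves s \<longleftrightarrow> v \<in> leaves t" if v: "v \<in> verts t" for v
    unfolding leaves_def im[symmetric] using v ch[OF v] by blast
  have sub: "leaves t \<subseteq> verts t" "leaves s \<subseteq> verts s" by (auto simp: leaves_def)
  have "f ` leaves t = leaves s"
  proof (intro set_eqI iffI)
    show "y \<in> leaves s" if "y \<in> f ` leaves t" for y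
      using that eq sub(1) by blast
    show "y \<in> f ` leaves t" if "y \<in> leaves s" for y
    proof -
      have "y \<in> f ` verts t" using that sub(2) im by blast
      then show ?thesis using that eq by blast
    qed
  qed
  then show ?thesis
    using inj_on_subset[OF inj sub(1)] by (simp add: bij_betw_def)
qed

text \<open>\<open>None\<close> is the empty tree; the space is the space of finitely supported functions on trees,
  and the tree \<open>T\<close> is the basis vector \<open>Poly_Mapping.single T 1\<close>.\<close>

type_synonym 'w tree0 = "'w rtree option"
type_synonym ('w, 'k) tree_space = "'w tree0 \<Rightarrow>\<^sub>0 'k"

definition scale :: "'k::field \<Rightarrow> ('b \<Rightarrow>\<^sub>0 'k) \<Rightarrow> ('b \<Rightarrow>\<^sub>0 'k)" where
  "scale c x = Poly_Mapping.map (\<lambda>a. c * a) x"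

definition bilinear_ext ::
  "('b \<Rightarrow> 'b \<Rightarrow> ('b \<Rightarrow>\<^sub>0 'k::field)) \<Rightarrow> ('b \<Rightarrow>\<^sub>0 'k) \<Rightarrow> ('b \<Rightarrow>\<^sub>0 'k) \<Rightarrow> ('b \<Rightarrow>\<^sub>0 'k)" where
  "bilinear_ext p x y =
     (\<Sum>S \<in> Poly_Mapping.keys x. \<Sum>T \<in> Poly_Mapping.keys y.
        scale (Poly_Mapping.lookup x S * Poly_Mapping.lookup y T) (p S T))"

fun graft0 :: "'w otree \<Rightarrow> address \<Rightarrow> 'w otree option \<Rightarrow> 'w otree" where
  "graft0 t v None = t"
| "graft0 t v (Some t') = graft t v t'"

text \<open>The vector \<open>\<Sum>\<^bsub>l \<in> \<ell>(T)\<^esub> T \<curvearrowleft>\<^bsub>l\<^esub> T'\<close> for nonempty \<open>T\<close>, on concrete trees and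
  then on isomorphism classes.\<close>

definition oleaf_sum :: "'w otree \<Rightarrow> 'w otree option \<Rightarrow> ('w, 'k::field) tree_space" where
  "oleaf_sum t t' = (\<Sum>l \<in> leaves t. Poly_Mapping.single (Some (abs_rtree (graft0 t l t'))) 1)"

lift_definition leaf_sum :: "'w rtree \<Rightarrow> 'w tree0 \<Rightarrow> ('w, 'k::field) tree_space"
  is oleaf_sum
proof -
  fix t s :: "'w otree" and t' s' :: "'w otree option"
  assume "otree_iso t s" and r: "rel_option otree_iso t' s'"
  then obtain f where f: "is_iso f t s" unfolding otree_iso_def by blast
  have "otree_iso (graft0 t l t') (graft0 s (f l) s')" if l: "l \<in> leaves t" for l
  proof (cases t')
    case None
    then show ?thesis using r \<open>otree_iso t s\<close> by simp
  next
    case (Some x)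
    then obtain y where y: "s' = Some y" "otree_iso x y" using r by (cases s') auto
    then obtain g where "is_iso g x y" unfolding otree_iso_def by blast
    then show ?thesis using Some y graft_iso[OF f] l by (simp add: leaves_def)
  qed
  then have "abs_rtree (graft0 t l t') = abs_rtree (graft0 s (f l) s')" if "l \<in> leaves t" for l
    using that by (simp add: rtree.abs_eq_iff)
  then have "oleaf_sum t t' =
      (\<Sum>l \<in> leaves t. Poly_Mapping.single (Some (abs_rtree (graft0 s (f l) s'))) (1::'k))"
    unfolding oleaf_sum_def by (intro sum.cong) auto
  also have "\<dots> = oleaf_sum s s'"
    unfolding oleaf_sum_def by (rule sum.reindex_bij_betw[OF bij_betw_leaves[OF f]])
  finally show "oleaf_sum t t' = (oleaf_sum s s' :: ('w, 'k) tree_space)" .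
qed

lift_definition num_leaves_nonempty :: "'w rtree \<Rightarrow> nat" is "\<lambda>t. card (leaves t)"
  unfolding otree_iso_def using bij_betw_leaves bij_betw_same_card by blast

fun num_leaves :: "'w tree0 \<Rightarrow> nat" where
  "num_leaves None = 0"
| "num_leaves (Some T) = num_leaves_nonempty T"

fun tree_lhd :: "'w tree0 \<Rightarrow> 'w tree0 \<Rightarrow> ('w, 'k::field) tree_space" where
  "tree_lhd None T' = Poly_Mapping.single T' 1"
| "tree_lhd (Some T) T' = leaf_sum T T'"

definition tree_unlhd :: "'w tree0 \<Rightarrow> 'w tree0 \<Rightarrow> ('w, 'k::field) tree_space" where
  "tree_unlhd T T' = (if num_leaves T > 1 then 0 else tree_lhd T T')"

definition lhd :: "('w, 'k::field) tree_space \<Rightarrow> ('w, 'k) tree_space \<Rightarrow> ('w, 'k) tree_space" where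
  "lhd = bilinear_ext tree_lhd"

definition unlhd :: "('w, 'k::field) tree_space \<Rightarrow> ('w, 'k) tree_space \<Rightarrow> ('w, 'k) tree_space" where
  "unlhd = bilinear_ext tree_unlhd"

text \<open>The chirality follows the source: "right" is the identity symmetric in the first two
  arguments, "left" the one symmetric in the last two (often named the other way round).\<close>

locale algebra_over = vector_space sc
  for sc :: "'k::field \<Rightarrow> 'b::ab_group_add \<Rightarrow> 'b" +
  fixes star :: "'b \<Rightarrow> 'b \<Rightarrow> 'b"
  assumes linear_left: "Vector_Spaces.linear sc sc (\<lambda>x. star x y)"
    and linear_right: "Vector_Spaces.linear sc sc (star x)"

locale right_pre_Lie_algebra = algebra_over +
  assumes right_pre_Lie:
    "star (star x y) z - star x (star y z) = star (star y x) z - star y (star x z)"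

locale left_pre_Lie_algebra = algebra_over +
  assumes left_pre_Lie:
    "star (star x y) z - star x (star y z) = star (star x z) y - star x (star z y)"

end

theory Submission
  imports Defs
begin

text \<open>
  Both pre-Lie identities say that the associator \<open>(x \<star> y) \<star> z - x \<star> (y \<star> z)\<close> is symmetric in
  two of its arguments. The associator is trilinear, so it is enough to look at it on trees.

  For \<open>\<lhd>\<close> take trees \<open>T \<noteq> \<emptyset>\<close>, \<open>T'\<close>, \<open>T''\<close>. A leaf of \<open>T\<close> with \<open>T'\<close> grafted on its leaf \<open>l\<close> is
  either a leaf \<open>m \<noteq> l\<close> of \<open>T\<close> or a leaf of the grafted copy of \<open>T'\<close>. Grafting \<open>T''\<close> on a leaf of
  the second kind is the same as grafting it on \<open>T'\<close> first; the sum of these terms is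
  \<open>T \<lhd> (T' \<lhd> T'')\<close>. The associator is therefore the sum, over all pairs of distinct leaves
  \<open>l \<noteq> m\<close> of \<open>T\<close>, of the tree with \<open>T'\<close> grafted on \<open>l\<close> and \<open>T''\<close> on \<open>m\<close>
  (\<open>lhd_associator_tree\<close>). Grafts at distinct vertices commute (\<open>graft_commute\<close>), so exchanging
  \<open>T'\<close> with \<open>T''\<close> only exchanges the roles of \<open>l\<close> and \<open>m\<close>.

  The formula remains true when \<open>T'\<close> or \<open>T''\<close> is empty: if \<open>T' = \<emptyset>\<close>, the leaf \<open>l\<close> survives the
  graft and its term is the one that \<open>\<emptyset> \<lhd> T'' = T''\<close> contributes to \<open>T \<lhd> (\<emptyset> \<lhd> T'')\<close>; if
  \<open>T'' = \<emptyset>\<close>, the second graft changes nothing, but the pairs of leaves are counted in the same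
  way. For \<open>T = \<emptyset>\<close> the associator is zero because
  \<open>\<emptyset>\<close> is a left unit.

  The product \<open>\<unlhd>\<close> is even associative. Left multiplication by a tree with several leaves is zero.
  A tree \<open>T\<close> with one leaf acts as for \<open>\<lhd>\<close>, and \<open>T \<unlhd> T'\<close> has several leaves if and only if \<open>T'\<close>
  has. If \<open>T'\<close> has several leaves, both terms of the associator vanish. Otherwise it is the
  associator of \<open>\<lhd>\<close>, a sum over the pairs of distinct leaves of \<open>T\<close>, of which there are none.
  The case \<open>T = \<emptyset>\<close> is again that of a left unit.
\<close>

section \<open>Spaces of finitely supported functions\<close>

lemma lookup_scale [simp]: "Poly_Mapping.lookup (scale c x) S = c * Poly_Mapping.lookup x S"
  unfolding scale_def by (transfer fixing: c) (simp add: when_def)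

lemma scale_single: "scale c (Poly_Mapping.single S d) = Poly_Mapping.single S (c * d)"
  by (rule poly_mapping_eqI) (simp add: lookup_single when_def)

lemma vector_space_scale: "vector_space scale"
  by unfold_locales (auto intro!: poly_mapping_eqI simp: lookup_add algebra_simps)

lemma linear_const_zero: "Vector_Spaces.linear scale scale (\<lambda>x :: 'b \<Rightarrow>\<^sub>0 'k::field. 0 :: 'b \<Rightarrow>\<^sub>0 'k)"
proof -
  interpret vector_space "scale :: 'k \<Rightarrow> ('b \<Rightarrow>\<^sub>0 'k) \<Rightarrow> _" by (rule vector_space_scale)
  show ?thesis by unfold_locales simp_all
qed

lemma linear_eq_on_singles:
  fixes f g :: "('b \<Rightarrow>\<^sub>0 'k::field) \<Rightarrow> ('b \<Rightarrow>\<^sub>0 'k)"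
  assumes f: "Vector_Spaces.linear scale scale f" and g: "Vector_Spaces.linear scale scale g"
    and eq: "\<And>S. f (Poly_Mapping.single S 1) = g (Poly_Mapping.single S 1)"
  shows "f x = g x"
proof -
  interpret f: Vector_Spaces.linear scale scale f by (rule f)
  interpret g: Vector_Spaces.linear scale scale g by (rule g)
  show ?thesis
  proof (induction x rule: update_induct)
    case const
    show ?case by simp
  next
    case (update x S c)
    have "Poly_Mapping.update S c x = x + scale c (Poly_Mapping.single S 1)"
      using update.hyps
      by (intro poly_mapping_eqI)
        (auto simp: update.rep_eq lookup_add lookup_single in_keys_iff when_def)
    then show ?case
      by (simp only: f.add g.add f.scale g.scale eq update.IH)
  qed
qed

lemma trilinear_eq_on_singles:
  fixes F G :: "('b \<Rightarrow>\<^sub>0 'k::field) \<Rightarrow> ('b \<Rightarrow>\<^sub>0 'k) \<Rightarrow> ('b \<Rightarrow>\<^sub>0 'k) \<Rightarrow> ('b \<Rightarrow>\<^sub>0 'k)"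
  assumes F: "\<And>y z. Vector_Spaces.linear scale scale (\<lambda>x. F x y z)"
      "\<And>x z. Vector_Spaces.linear scale scale (\<lambda>y. F x y z)"
      "\<And>x y. Vector_Spaces.linear scale scale (\<lambda>z. F x y z)"
    and G: "\<And>y z. Vector_Spaces.linear scale scale (\<lambda>x. G x y z)"
      "\<And>x z. Vector_Spaces.linear scale scale (\<lambda>y. G x y z)"
      "\<And>x y. Vector_Spaces.linear scale scale (\<lambda>z. G x y z)"
    and eq: "\<And>R S T. F (Poly_Mapping.single R 1) (Poly_Mapping.single S 1) (Poly_Mapping.single T 1)
      = G (Poly_Mapping.single R 1) (Poly_Mapping.single S 1) (Poly_Mapping.single T 1)"
  shows "F x y z = G x y z"
proof -
  have "F (Poly_Mapping.single R 1) (Poly_Mapping.single S 1) z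
      = G (Poly_Mapping.single R 1) (Poly_Mapping.single S 1) z" for R S z
    by (rule linear_eq_on_singles[OF F(3) G(3) eq])
  then have "F (Poly_Mapping.single R 1) y z = G (Poly_Mapping.single R 1) y z" for R y z
    by (rule linear_eq_on_singles[OF F(2) G(2)])
  then show ?thesis
    by (rule linear_eq_on_singles[OF F(1) G(1)])
qed

text \<open>Additivity of \<open>bilinear_ext\<close> compares expansions of vectors with different supports, so the
  sums must be taken over common finite supersets of these supports.\<close>

lemma bilinear_ext_superset:
  fixes p :: "'b \<Rightarrow> 'b \<Rightarrow> ('b \<Rightarrow>\<^sub>0 'k::field)"
  assumes A: "finite A" "Poly_Mapping.keys x \<subseteq> A"
    and B: "finite B" "Poly_Mapping.keys y \<subseteq> B"
  shows "bilinear_ext p x y =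
    (\<Sum>S\<in>A. \<Sum>T\<in>B. scale (Poly_Mapping.lookup x S * Poly_Mapping.lookup y T) (p S T))"
proof -
  interpret vector_space "scale :: 'k \<Rightarrow> ('b \<Rightarrow>\<^sub>0 'k) \<Rightarrow> _" by (rule vector_space_scale)
  have "(\<Sum>T\<in>Poly_Mapping.keys y.
          scale (Poly_Mapping.lookup x S * Poly_Mapping.lookup y T) (p S T))
      = (\<Sum>T\<in>B. scale (Poly_Mapping.lookup x S * Poly_Mapping.lookup y T) (p S T))" for S
    by (intro sum.mono_neutral_left) (use B in \<open>auto simp: in_keys_iff\<close>)
  then show ?thesis
    unfolding bilinear_ext_def
    by (simp, intro sum.mono_neutral_left) (use A in \<open>auto simp: in_keys_iff\<close>)
qed

lemma bilinear_ext_single: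
  "bilinear_ext p (Poly_Mapping.single S 1) (Poly_Mapping.single T 1) = p S T"
  by (subst bilinear_ext_superset[of "{S}" _ "{T}"])
    (auto intro: poly_mapping_eqI)

lemma algebra_over_bilinear_ext:
  fixes p :: "'b \<Rightarrow> 'b \<Rightarrow> ('b \<Rightarrow>\<^sub>0 'k::field)"
  shows "algebra_over scale (bilinear_ext p)"
proof -
  interpret vs: vector_space "scale :: 'k \<Rightarrow> ('b \<Rightarrow>\<^sub>0 'k) \<Rightarrow> _" by (rule vector_space_scale)
  have add_left: "bilinear_ext p (x + x') y = bilinear_ext p x y + bilinear_ext p x' y"
    for x x' y
  proof -
    let ?A = "Poly_Mapping.keys x \<union> Poly_Mapping.keys x'"
    have "Poly_Mapping.keys (x + x') \<subseteq> ?A" by (rule keys_add)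
    then show ?thesis
      by (simp add: bilinear_ext_superset[of ?A _ "Poly_Mapping.keys y"] lookup_add
          distrib_right vs.scale_left_distrib sum.distrib)
  qed
  have add_right: "bilinear_ext p x (y + y') = bilinear_ext p x y + bilinear_ext p x y'"
    for x y y'
  proof -
    let ?B = "Poly_Mapping.keys y \<union> Poly_Mapping.keys y'"
    have "Poly_Mapping.keys (y + y') \<subseteq> ?B" by (rule keys_add)
    then show ?thesis
      by (simp add: bilinear_ext_superset[of "Poly_Mapping.keys x" _ ?B] lookup_add
          distrib_left vs.scale_left_distrib sum.distrib)
  qed
  have keys_scale: "Poly_Mapping.keys (scale c x) \<subseteq> Poly_Mapping.keys x"
    for c and x :: "'b \<Rightarrow>\<^sub>0 'k"
    by (auto simp: in_keys_iff)
  have scale_left: "bilinear_ext p (scale c x) y = scale c (bilinear_ext p x y)" for c x y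
    using keys_scale[of c x]
    by (simp add: bilinear_ext_superset[of "Poly_Mapping.keys x" _ "Poly_Mapping.keys y"]
        vs.scale_sum_right mult.assoc)
  have scale_right: "bilinear_ext p x (scale c y) = scale c (bilinear_ext p x y)" for c x y
    using keys_scale[of c y]
    by (simp add: bilinear_ext_superset[of "Poly_Mapping.keys x" _ "Poly_Mapping.keys y"]
        vs.scale_sum_right mult.left_commute)
  show ?thesis
    by unfold_locales (simp_all add: add_left add_right scale_left scale_right)
qed

section \<open>The associator\<close>

context algebra_over
begin

interpretation left: Vector_Spaces.linear sc sc "\<lambda>x. star x y" for y
  by (rule linear_left)

interpretation right: Vector_Spaces.linear sc sc "star x" for x
  by (rule linear_right)

definition associator :: "'b \<Rightarrow> 'b \<Rightarrow> 'b \<Rightarrow> 'b" where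
  "associator x y z = star (star x y) z - star x (star y z)"

lemma associator_linear:
  "Vector_Spaces.linear sc sc (\<lambda>x. associator x y z)"
  "Vector_Spaces.linear sc sc (\<lambda>y. associator x y z)"
  "Vector_Spaces.linear sc sc (\<lambda>z. associator x y z)"
  unfolding associator_def
  by unfold_locales
    (simp_all add: left.add right.add left.scale right.scale scale_right_diff_distrib)

lemma star_sum_left: "star (\<Sum>i\<in>I. x i) y = (\<Sum>i\<in>I. star (x i) y)"
  by (rule left.sum)

lemma star_sum_right: "star x (\<Sum>i\<in>I. y i) = (\<Sum>i\<in>I. star x (y i))"
  by (rule right.sum)

lemma star_zero_left: "star 0 y = 0"
  by (rule left.zero)

lemma star_zero_right: "star x 0 = 0"
  by (rule right.zero)

end

section \<open>Grafting on leaves\<close>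

lemma nch_leaf:
  assumes "l \<in> leaves t"
  shows "nch t l = 0"
proof (rule ccontr)
  assume "nch t l \<noteq> 0"
  then have "l @ [0] \<in> verts t"
    using assms
    by (auto simp: leaves_def verts_def nch_def subtree_append split: otree.splits option.splits)
  then show False using assms by (auto simp: leaves_def child_def)
qed

lemma finite_leaves [simp]: "finite (leaves t)"
  by (rule finite_subset[OF _ finite_verts]) (auto simp: leaves_def)

text \<open>A leaf \<open>l\<close> has no children, so the graft becomes its child number \<open>0\<close>: the vertex \<open>m\<close> of the
  grafted tree gets the address \<open>l @ 0 # m\<close>. The only old vertex with a new child is \<open>l\<close>, which
  therefore stops being a leaf.\<close>

lemma leaves_graft:
  assumes l: "l \<in> leaves t"
  shows "leaves (graft t l s) = (leaves t - {l}) \<union> (\<lambda>m. l @ 0 # m) ` leaves s"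
proof -
  have v: "l \<in> verts t" and n: "nch t l = 0"
    using l nch_leaf by (auto simp: leaves_def)
  have V: "verts (graft t l s) = verts t \<union> (\<lambda>w. l @ 0 # w) ` verts s"
    using verts_graft[OF v] n by simp
  have old_new: "child u (l @ 0 # w) \<longleftrightarrow> u = l \<and> w = []" if "u \<in> verts t" for u w
    using child_old_new[OF that, of l w] n by simp
  have new_old: "\<not> child (l @ 0 # w) u" if "u \<in> verts t" for u w
    using not_child_new_old[OF that, of l w] n by simp
  have old: "u \<in> leaves (graft t l s) \<longleftrightarrow> u \<in> leaves t - {l}" if "u \<in> verts t" for u
  proof -
    have "\<not> (\<forall>w\<in>verts t \<union> (\<lambda>w. l @ 0 # w) ` verts s. \<not> child l w)"
      using old_new[OF v, of "[]"] root_in_verts[of s] by blast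
    then show ?thesis
      using that l unfolding leaves_def V by (auto simp: old_new)
  qed
  have new: "l @ 0 # w \<in> leaves (graft t l s) \<longleftrightarrow> w \<in> leaves s" if "w \<in> verts s" for w
    using that unfolding leaves_def V by (auto simp: new_old child_new_new ball_Un)
  have "leaves (graft t l s) \<subseteq> verts t \<union> (\<lambda>w. l @ 0 # w) ` verts s"
    "leaves t \<subseteq> verts t" "leaves s \<subseteq> verts s"
    by (auto simp: leaves_def simp flip: V)
  then show ?thesis
    using old new by blast
qed

lemma leaves_graft_disjoint:
  assumes "l \<in> leaves t"
  shows "(leaves t - {l}) \<inter> (\<lambda>m. l @ 0 # m) ` leaves s = {}"
  using new_not_in_verts[of l t] nch_leaf[OF assms] by (auto simp: leaves_def)

lemma sum_leaves_graft:
  assumes "l \<in> leaves t"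
  shows "(\<Sum>m\<in>leaves (graft t l s). f m)
    = (\<Sum>m\<in>leaves t - {l}. f m) + (\<Sum>m\<in>leaves s. f (l @ 0 # m))"
  by (simp add: leaves_graft[OF assms] leaves_graft_disjoint[OF assms] sum.union_disjoint
      sum.reindex inj_on_def)

lemma card_leaves_graft:
  assumes "l \<in> leaves t"
  shows "card (leaves (graft t l s)) = card (leaves t) - 1 + card (leaves s)"
  using sum_leaves_graft[OF assms, of "\<lambda>_. 1 :: nat" s] assms by simp

text \<open>Together with \<open>graft_commute\<close> this gives all that the associator needs to know about iterated
  grafts. Both hold for concrete trees, and not only up to isomorphism.\<close>

lemma graft_assoc:
  "v \<in> verts t \<Longrightarrow> graft (graft t v s) (v @ nch t v # w) r = graft t v (graft s w r)"
proof (induction t v s rule: graft.induct)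
  case (1 a ts s)
  then show ?case by (simp add: nch_def)
next
  case (2 a ts i v s)
  then show ?case by (auto simp: nch_def verts_def split: if_splits)
qed

text \<open>A graft is added as a last child, so it does not change the addresses of the vertices that were
  already there. If \<open>v = w\<close>, the two sides list the two new children in opposite orders.\<close>

lemma graft_commute:
  "v \<in> verts t \<Longrightarrow> w \<in> verts t \<Longrightarrow> v \<noteq> w \<Longrightarrow>
    graft (graft t v s) w r = graft (graft t w r) v s"
proof (induction t v s arbitrary: w rule: graft.induct)
  case (1 a ts s)
  then show ?case
    by (cases w) (auto simp: verts_def nth_append list_update_append split: if_splits)
next
  case (2 a ts i v s)
  show ?case
  proof (cases w)
    case Nil
    then show ?thesis using 2
      by (auto simp: verts_def nth_append list_update_append split: if_splits)
  next
    case (Cons j w')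
    then show ?thesis using 2
      by (cases "i = j") (auto simp: verts_def list_update_swap split: if_splits)
  qed
qed

lemma graft0_commute:
  assumes "v \<in> verts t" "w \<in> verts t" "v \<noteq> w"
  shows "graft0 (graft0 t v s) w r = graft0 (graft0 t w r) v s"
  using graft_commute[OF assms] by (cases s; cases r) auto

section \<open>The two products\<close>

text \<open>Basis vectors are written through concrete representatives of trees, because the leaves that
  index the sums below are addresses in a concrete tree.\<close>

abbreviation tree_vector :: "'w otree option \<Rightarrow> ('w, 'k::field) tree_space" where
  "tree_vector t \<equiv> Poly_Mapping.single (map_option abs_rtree t) 1"

lemma tree_vector_cases:
  obtains t where "Poly_Mapping.single T 1 = (tree_vector t :: ('w, 'k::field) tree_space)"
proof (cases T)
  case None
  then show ?thesis using that[of None] by simp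
next
  case (Some T')
  obtain t where "T' = abs_rtree t" by (metis Quotient_rtree Quotient_abs_rep)
  then show ?thesis using Some that[of "Some t"] by simp
qed

interpretation lhd: algebra_over scale "lhd :: ('w, 'k::field) tree_space \<Rightarrow> _"
  unfolding lhd_def by (rule algebra_over_bilinear_ext)

interpretation unlhd: algebra_over scale "unlhd :: ('w, 'k::field) tree_space \<Rightarrow> _"
  unfolding unlhd_def by (rule algebra_over_bilinear_ext)

lemma lhd_empty: "lhd (tree_vector None) y = y"
proof (rule linear_eq_on_singles[OF lhd.linear_right])
  show "Vector_Spaces.linear scale scale (\<lambda>x. x :: ('w, 'k::field) tree_space)"
    by (rule lhd.linear_ident)
qed (simp add: lhd_def bilinear_ext_single)

lemma lhd_tree:
  "lhd (tree_vector (Some t)) (tree_vector s)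
    = (\<Sum>l\<in>leaves t. tree_vector (Some (graft0 t l s)))"
  by (simp add: lhd_def bilinear_ext_single leaf_sum.abs_eq oleaf_sum_def)

lemma unlhd_branching:
  fixes y :: "('w, 'k::field) tree_space"
  assumes "num_leaves (map_option abs_rtree t) > 1"
  shows "unlhd (tree_vector t) y = 0"
  by (rule linear_eq_on_singles[OF unlhd.linear_right linear_const_zero])
    (use assms in \<open>simp add: unlhd_def bilinear_ext_single tree_unlhd_def\<close>)

lemma unlhd_nonbranching:
  fixes y :: "('w, 'k::field) tree_space"
  assumes "\<not> num_leaves (map_option abs_rtree t) > 1"
  shows "unlhd (tree_vector t) y = lhd (tree_vector t) y"
  by (rule linear_eq_on_singles[OF unlhd.linear_right lhd.linear_right])
    (use assms in \<open>simp add: unlhd_def lhd_def bilinear_ext_single tree_unlhd_def\<close>)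

lemma lhd_associator_empty: "lhd.associator (tree_vector None) y z = 0"
  by (simp only: lhd.associator_def lhd_empty diff_self)

text \<open>The terms of \<open>(T \<lhd> T') \<lhd> T''\<close> whose second graft lands inside the first one, or on the same
  leaf when \<open>T'\<close> is empty, make up \<open>T \<lhd> (T' \<lhd> T'')\<close>.\<close>

lemma lhd_associator_tree:
  fixes t :: "'w otree"
  shows "lhd.associator (tree_vector (Some t)) (tree_vector s) (tree_vector r)
    = (\<Sum>l\<in>leaves t. \<Sum>m\<in>leaves t - {l}. tree_vector (Some (graft0 (graft0 t l s) m r))
        :: ('w, 'k::field) tree_space)"
    (is "_ = ?R")
proof -
  let ?v = "\<lambda>t. tree_vector (Some t) :: ('w, 'k) tree_space"
  have "lhd (lhd (?v t) (tree_vector s)) (tree_vector r)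
    = (\<Sum>l\<in>leaves t. \<Sum>m\<in>leaves (graft0 t l s). ?v (graft0 (graft0 t l s) m r))"
    by (simp only: lhd_tree lhd.star_sum_left)
  also have "\<dots> = ?R + lhd (?v t) (lhd (tree_vector s) (tree_vector r))"
  proof (cases s)
    case None
    have "(\<Sum>m\<in>leaves t. ?v (graft0 t m r))
        = (\<Sum>m\<in>leaves t - {l}. ?v (graft0 t m r)) + ?v (graft0 t l r)" if "l \<in> leaves t" for l
      using that by (simp add: sum.remove add.commute)
    then have "(\<Sum>l\<in>leaves t. \<Sum>m\<in>leaves t. ?v (graft0 t m r))
        = (\<Sum>l\<in>leaves t. (\<Sum>m\<in>leaves t - {l}. ?v (graft0 t m r)) + ?v (graft0 t l r))"
      by (intro sum.cong refl)
    then show ?thesis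
      by (simp only: None lhd_empty lhd_tree graft0.simps sum.distrib)
  next
    case (Some s')
    have assoc: "graft0 (graft t l s') (l @ 0 # m) r = graft t l (graft0 s' m r)"
      if "l \<in> leaves t" for l m
      using that graft_assoc[of l t s' m] nch_leaf[OF that] by (cases r) (auto simp: leaves_def)
    have "(\<Sum>l\<in>leaves t. \<Sum>m\<in>leaves (graft t l s'). ?v (graft0 (graft t l s') m r))
      = (\<Sum>l\<in>leaves t. (\<Sum>m\<in>leaves t - {l}. ?v (graft0 (graft t l s') m r))
          + (\<Sum>m\<in>leaves s'. ?v (graft t l (graft0 s' m r))))"
      by (rule sum.cong) (simp_all only: sum_leaves_graft assoc)
    moreover have "lhd (?v t) (lhd (?v s') (tree_vector r))
      = (\<Sum>l\<in>leaves t. \<Sum>m\<in>leaves s'. ?v (graft t l (graft0 s' m r)))"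
      by (simp only: lhd_tree lhd.star_sum_right graft0.simps) (rule sum.swap)
    ultimately show ?thesis
      by (simp only: Some graft0.simps sum.distrib)
  qed
  finally show ?thesis by (simp add: lhd.associator_def)
qed

lemma lhd_associator_symmetric: "lhd.associator x y z = lhd.associator x z y"
proof (rule trilinear_eq_on_singles[of lhd.associator "\<lambda>x y z. lhd.associator x z y"])
  fix R S T :: "'w tree0"
  obtain t s r where eq: "Poly_Mapping.single R 1 = (tree_vector t :: ('w, 'k::field) tree_space)"
      "Poly_Mapping.single S 1 = (tree_vector s :: ('w, 'k) tree_space)"
      "Poly_Mapping.single T 1 = (tree_vector r :: ('w, 'k) tree_space)"
    by (metis tree_vector_cases)
  show "lhd.associator (Poly_Mapping.single R 1) (Poly_Mapping.single S 1)
      (Poly_Mapping.single T (1 :: 'k))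
    = lhd.associator (Poly_Mapping.single R 1) (Poly_Mapping.single T 1) (Poly_Mapping.single S 1)"
  proof (cases t)
    case None
    then show ?thesis unfolding eq by (simp only: lhd_associator_empty)
  next
    case (Some t')
    have verts: "l \<in> verts t'" if "l \<in> leaves t'" for l
      using that by (simp add: leaves_def)
    have "(\<Sum>l\<in>leaves t'. \<Sum>m\<in>leaves t' - {l}. tree_vector (Some (graft0 (graft0 t' l s) m r)))
      = (\<Sum>m\<in>leaves t'. \<Sum>l\<in>leaves t' - {m}.
          tree_vector (Some (graft0 (graft0 t' l s) m r)) :: ('w, 'k) tree_space)"
      \<comment> \<open>The inner index set depends on the outer index, so the swap goes through pairs.\<close>
      unfolding sum.Sigma[OF finite_leaves ballI, OF finite_Diff[OF finite_leaves]]
      by (rule sum.reindex_bij_witness[of _ "\<lambda>(m, l). (l, m)" "\<lambda>(l, m). (m, l)"]) auto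
    also have "\<dots> = (\<Sum>m\<in>leaves t'. \<Sum>l\<in>leaves t' - {m}.
          tree_vector (Some (graft0 (graft0 t' m r) l s)))"
      by (intro sum.cong refl) (auto simp: verts graft0_commute)
    finally show ?thesis
      unfolding eq Some by (simp only: lhd_associator_tree)
  qed
qed (rule lhd.associator_linear)+

text \<open>A left factor with one leaf is a chain, and acts by placing the right factor below its end,
  which is an associative operation; a left factor with several leaves makes both terms zero.\<close>

lemma unlhd_associator_zero: "unlhd.associator x y z = 0"
proof (rule trilinear_eq_on_singles[of unlhd.associator "\<lambda>x y z. 0"])
  fix R S T :: "'w tree0"
  obtain t s r where eq: "Poly_Mapping.single R 1 = (tree_vector t :: ('w, 'k::field) tree_space)"
      "Poly_Mapping.single S 1 = (tree_vector s :: ('w, 'k) tree_space)"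
      "Poly_Mapping.single T 1 = (tree_vector r :: ('w, 'k) tree_space)"
    by (metis tree_vector_cases)
  show "unlhd.associator (Poly_Mapping.single R 1) (Poly_Mapping.single S 1)
      (Poly_Mapping.single T (1 :: 'k)) = 0"
  proof (cases "num_leaves (map_option abs_rtree t) > 1")
    case True
    then show ?thesis
      unfolding eq by (simp only: unlhd.associator_def unlhd_branching unlhd.star_zero_left diff_self)
  next
    case False
    note t_acts = unlhd_nonbranching[OF False]
    show ?thesis
    proof (cases t)
      case None
      show ?thesis
        unfolding eq unlhd.associator_def t_acts
        by (simp only: None lhd_empty diff_self)
    next
      case (Some t')
      have one: "card (leaves t') \<le> 1"
        using False Some by (simp add: num_leaves_nonempty.abs_eq)
      have sole: "leaves t' = {l}" if "l \<in> leaves t'" for l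
        using that one by (auto simp: card_le_Suc0_iff_eq)
      \<comment> \<open>The graft replaces the only leaf of \<open>t'\<close> by the leaves of \<open>s\<close>, if \<open>s\<close> is nonempty.\<close>
      have branching_graft: "num_leaves (map_option abs_rtree (Some (graft0 t' l s))) > 1
          \<longleftrightarrow> num_leaves (map_option abs_rtree s) > 1" if "l \<in> leaves t'" for l
        using card_leaves_graft[OF that] sole[OF that]
        by (cases s) (simp_all add: num_leaves_nonempty.abs_eq)
      show ?thesis
      proof (cases "num_leaves (map_option abs_rtree s) > 1")
        case True
        have "unlhd (lhd (tree_vector t) (tree_vector s)) (tree_vector r)
            = (\<Sum>l\<in>leaves t'. 0 :: ('w, 'k) tree_space)"
          unfolding Some lhd_tree unlhd.star_sum_left
          by (intro sum.cong refl unlhd_branching) (simp only: branching_graft True)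
        then show ?thesis
          unfolding eq unlhd.associator_def t_acts unlhd_branching[OF True] lhd.star_zero_right
          by simp
      next
        case False
        have "unlhd (lhd (tree_vector t) (tree_vector s)) (tree_vector r)
            = (lhd (lhd (tree_vector t) (tree_vector s)) (tree_vector r)
                :: ('w, 'k) tree_space)"
          unfolding Some lhd_tree[of t' s] unlhd.star_sum_left lhd.star_sum_left
          by (intro sum.cong refl unlhd_nonbranching) (simp only: branching_graft False not_False_eq_True)
        then have "unlhd.associator (tree_vector t) (tree_vector s) (tree_vector r)
            = (lhd.associator (tree_vector t) (tree_vector s) (tree_vector r)
                :: ('w, 'k) tree_space)"
          unfolding unlhd.associator_def lhd.associator_def t_acts unlhd_nonbranching[OF False]
          by simp
        also have "\<dots> = 0"
          unfolding Some lhd_associator_tree using sole by (intro sum.neutral) auto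
        finally show ?thesis unfolding eq .
      qed
    qed
  qed
qed (rule unlhd.associator_linear linear_const_zero)+

theorem proposition2p9:
  shows "right_pre_Lie_algebra scale (unlhd :: ('w, 'k::field) tree_space \<Rightarrow> _ \<Rightarrow> _)
       \<and> left_pre_Lie_algebra scale (unlhd :: ('w, 'k) tree_space \<Rightarrow> _ \<Rightarrow> _)
       \<and> left_pre_Lie_algebra scale (lhd :: ('w, 'k) tree_space \<Rightarrow> _ \<Rightarrow> _)"
proof (intro conjI)
  show "right_pre_Lie_algebra scale (unlhd :: ('w, 'k) tree_space \<Rightarrow> _ \<Rightarrow> _)"
    by unfold_locales (simp only: unlhd_associator_zero flip: unlhd.associator_def)
  show "left_pre_Lie_algebra scale (unlhd :: ('w, 'k) tree_space \<Rightarrow> _ \<Rightarrow> _)"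
    by unfold_locales (simp only: unlhd_associator_zero flip: unlhd.associator_def)
  show "left_pre_Lie_algebra scale (lhd :: ('w, 'k) tree_space \<Rightarrow> _ \<Rightarrow> _)"
    by unfold_locales (use lhd_associator_symmetric in \<open>simp only: lhd.associator_def\<close>)
qed

end
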